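(* Let $w_1$ be the weight system of height $1$ on the lecture hall graph defined by \[ w_1(0;i,j)=\frac{q^j(1-abq^{i+1})(1-aq^{i+1})}{(1-abq^{i+j+1})(1-abq^{i+j+2})}\qquad(0\le j\le i) \] (and $w_1(t;i,j)=0$ for $t\ge1$). Then the mixed moments $\sigma^L_{n,k}(a,b;q)$ of the little $q$-Jacobi polynomials satisfy \[ \sigma^L_{n,k}(a,b;q)=h^{w_1}_{n,k}\qquad(n\ge k\ge0). \]
   Context: Lecture hall graph. For integers $t\ge0$, $0\le j\le i$ put $v^t_{i,j}=(i,\,t+\frac{j}{i+1})$, and set $v^t_{i,i+1}:=v^{t+1}_{i,0}$. The vertices of the lecture hall graph are all $v^t_{i,j}$; its edges join $v^t_{i,j}$ with $v^t_{i,j+1}$ (vertical edges) and $v^t_{i,j}$ with $v^t_{i+1,j}$, for $t\ge 0$, $0\le j\le i$. An east step is a directed edge $(v^t_{i,j},v^t_{i+1,j})$; a south step is a vertical edge directed downwards, $(v^t_{i,j+1},v^t_{i,j})$. A weight system $w$ assigns a weight $w(t;i,j)$ to each east step $(v^t_{i,j},v^t_{i+1,j})$; its height is the smallest integer $\ell$ with $w(t;i,j)=0$ for all $t\ge\ell$. The weight $w(p)$ of a path is the product of the weights of its east steps. $\mathrm{SE}((k,\infty)\to(n,0))$ is the set of paths $(\dots,v_2,v_1,v_0)$ with $v_0=(n,0)$, $\lim_{m\to\infty}v_m=(k,\infty)$, and each $(v_{m+1},v_m)$ a south or east step. Define $h^w_{n,k}=\sum_{p\in \mathrm{SE}((k,\infty)\to(n,0))}w(p)$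 (so $h^w_{n,n}=1$). Little $q$-Jacobi polynomials. The monic little $q$-Jacobi polynomials are \[ p_n(x;a,b;q)=\frac{(aq;q)_n}{(-1)^nq^{-\binom n2}(abq^{n+1};q)_n}\;{}_2\phi_1\!\left(\begin{matrix} q^{-n},\, abq^{n+1} \\ aq \end{matrix};q,qx\right), \] where ${}_2\phi_1(\alpha_1,\alpha_2;\beta;q,z)=\sum_{k\ge0}\frac{(\alpha_1;q)_k(\alpha_2;q)_k}{(q;q)_k(\beta;q)_k}z^k$ and $(z;q)_k=\prod_{i=0}^{k-1}(1-zq^i)$. The mixed moments are defined by $x^n=\sum_{k=0}^n\sigma^L_{n,k}(a,b;q)\,p_k(x;a,b;q)$. Here $a,b,q$ are indeterminates. *)

theory Defs
  imports
    "HOL-Analysis.Analysis"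
    "HOL-Library.Groups_Big_Fun"
    "HOL-Computational_Algebra.Computational_Algebra"
begin

section \<open>The lecture hall graph\<close>

text \<open>The vertex \<open>v\<^sup>t\<^bsub>i,j\<^esub>\<close>. The convention \<open>v\<^sup>t\<^bsub>i,i+1\<^esub> = v\<^sup>t\<^sup>+\<^sup>1\<^bsub>i,0\<^esub>\<close> holds
  automatically in these coordinates.\<close>

definition lh_vertex :: "nat \<Rightarrow> nat \<Rightarrow> nat \<Rightarrow> nat \<times> real" where
  "lh_vertex t i j = (i, real t + real j / real (i + 1))"

lemma lh_vertex_Suc: "lh_vertex t i (i + 1) = lh_vertex (t + 1) i 0"
  by (simp add: lh_vertex_def)

definition east_step :: "nat \<times> real \<Rightarrow> nat \<times> real \<Rightarrow> bool" where
  "east_step u v \<longleftrightarrow> (\<exists>t i j. j \<le> i \<and> u = lh_vertex t i j \<and> v = lh_vertex t (i + 1) j)"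

definition south_step :: "nat \<times> real \<Rightarrow> nat \<times> real \<Rightarrow> bool" where
  "south_step u v \<longleftrightarrow> (\<exists>t i j. j \<le> i \<and> u = lh_vertex t i (j + 1) \<and> v = lh_vertex t i j)"

text \<open>A weight system gives the weights \<open>w t i j\<close> of the east steps; only the values with
  \<open>j \<le> i\<close> are relevant.\<close>

type_synonym 'a weight_system = "nat \<Rightarrow> nat \<Rightarrow> nat \<Rightarrow> 'a"

definition lh_height :: "'a::zero weight_system \<Rightarrow> nat" where
  "lh_height w = (LEAST l. \<forall>t\<ge>l. \<forall>i j. j \<le> i \<longrightarrow> w t i j = 0)"

text \<open>The triple \<open>(t, i, j)\<close> labelling an east step is unique.\<close>

definition east_weight :: "'a weight_system \<Rightarrow> nat \<times> real \<Rightarrow> nat \<times> real \<Rightarrow> 'a" where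
  "east_weight w u v =
     (case (THE (t, i, j). j \<le> i \<and> u = lh_vertex t i j \<and> v = lh_vertex t (i + 1) j) of
        (t, i, j) \<Rightarrow> w t i j)"

text \<open>Paths are indexed from their end point: \<open>p m\<close> is the vertex \<open>v\<^sub>m\<close> of
  \<open>(\<dots>, v\<^sub>2, v\<^sub>1, v\<^sub>0)\<close>.\<close>

definition SE_paths :: "nat \<Rightarrow> nat \<Rightarrow> (nat \<Rightarrow> nat \<times> real) set" where
  "SE_paths k n =
     {p. p 0 = (n, 0) \<and>
         ((\<lambda>m. (fst (p m), ereal (snd (p m)))) \<longlonglongrightarrow> (k, \<infinity>)) \<and>
         (\<forall>m. south_step (p (Suc m)) (p m) \<or> east_step (p (Suc m)) (p m))}"

text \<open>A path in \<open>SE_paths k n\<close> has exactly \<open>n - k\<close> east steps, so the product is finite.\<close>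

definition path_weight :: "'a::comm_monoid_mult weight_system \<Rightarrow> (nat \<Rightarrow> nat \<times> real) \<Rightarrow> 'a" where
  "path_weight w p =
     (\<Prod>m\<in>{m. east_step (p (Suc m)) (p m)}. east_weight w (p (Suc m)) (p m))"

text \<open>\<open>SE_paths k n\<close> is infinite for \<open>k < n\<close>, but only finitely many of its paths have
  non-zero weight if \<open>w\<close> has finite height; \<open>h\<close> is the sum over those.\<close>

definition lh_h :: "'a::comm_semiring_1 weight_system \<Rightarrow> nat \<Rightarrow> nat \<Rightarrow> 'a" where
  "lh_h w n k = (\<Sum>p\<in>{p \<in> SE_paths k n. path_weight w p \<noteq> 0}. path_weight w p)"


section \<open>Little \<open>q\<close>-Jacobi polynomials\<close>

definition qpoch :: "'a::comm_ring_1 \<Rightarrow> 'a \<Rightarrow> nat \<Rightarrow> 'a" where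
  "qpoch z q k = (\<Prod>i<k. 1 - z * q ^ i)"

text \<open>The argument \<open>z\<close> is a polynomial. The sum over all \<open>k\<close> is a \<^const>\<open>Sum_any\<close>, i.e. the sum
  of the non-zero terms, of which there are finitely many when the series terminates, as it does
  for \<open>\<alpha>\<^sub>1 = q\<^sup>-\<^sup>n\<close>.\<close>

definition phi21 :: "'a::field \<Rightarrow> 'a \<Rightarrow> 'a \<Rightarrow> 'a \<Rightarrow> 'a poly \<Rightarrow> 'a poly" where
  "phi21 \<alpha>1 \<alpha>2 \<beta> q z =
     Sum_any (\<lambda>k::nat. smult ((qpoch \<alpha>1 q k * qpoch \<alpha>2 q k) / (qpoch q q k * qpoch \<beta> q k)) (z ^ k))"

definition little_q_jacobi :: "'a::field \<Rightarrow> 'a \<Rightarrow> 'a \<Rightarrow> nat \<Rightarrow> 'a poly" where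
  "little_q_jacobi a b q n =
     smult (qpoch (a * q) q n /
              ((-1) ^ n * q powi (- int (n choose 2)) * qpoch (a * b * q ^ (n + 1)) q n))
       (phi21 (q powi (- int n)) (a * b * q ^ (n + 1)) (a * q) q [:0, q:])"

text \<open>The coefficients of \<open>x\<^sup>n\<close> in a sequence \<open>p\<close> of polynomials with \<open>deg p\<^sub>n = n\<close>; the second
  condition only fixes the irrelevant values with \<open>n < k\<close>.\<close>

definition mixed_moments :: "(nat \<Rightarrow> 'a::field poly) \<Rightarrow> nat \<Rightarrow> nat \<Rightarrow> 'a" where
  "mixed_moments p =
     (THE \<sigma>. (\<forall>n. monom 1 n = (\<Sum>k=0..n. smult (\<sigma> n k) (p k))) \<and>
             (\<forall>n k. n < k \<longrightarrow> \<sigma> n k = 0))"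

definition sigma_L :: "'a::field \<Rightarrow> 'a \<Rightarrow> 'a \<Rightarrow> nat \<Rightarrow> nat \<Rightarrow> 'a" where
  "sigma_L a b q = mixed_moments (little_q_jacobi a b q)"

definition w_one :: "'a::field \<Rightarrow> 'a \<Rightarrow> 'a \<Rightarrow> 'a weight_system" where
  "w_one a b q t i j =
     (if t = 0
      then q ^ j * (1 - a * b * q ^ (i + 1)) * (1 - a * q ^ (i + 1)) /
             ((1 - a * b * q ^ (i + j + 1)) * (1 - a * b * q ^ (i + j + 2)))
      else 0)"


section \<open>Indeterminates\<close>

text \<open>The field \<open>F(a, b, q)\<close> of rational functions over an arbitrary field \<open>F\<close>, as the fraction
  field of \<open>F[a][b][q]\<close>.\<close>

type_synonym 'k ratfun3 = "'k poly poly poly fract"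

definition ind_a :: "'k::field ratfun3" where "ind_a = to_fract [:[:[:0, 1:]:]:]"
definition ind_b :: "'k::field ratfun3" where "ind_b = to_fract [:[:0, 1:]:]"
definition ind_q :: "'k::field ratfun3" where "ind_q = to_fract [:0, 1:]"

text \<open>The weight system \<open>w\<^sub>1\<close> indeed has height \<open>1\<close>.\<close>

lemma lh_height_w_one: "lh_height (w_one (ind_a :: 'k::field ratfun3) ind_b ind_q) = 1"
proof -
  have poly0: "to_fract P \<noteq> (0 :: 'k ratfun3)" if "poly P 0 = 1" for P :: "'k poly poly poly"
    using that by auto
  have A: "1 - ind_a * ind_q \<noteq> (0 :: 'k ratfun3)"
    using poly0[of "1 - [:[:[:0, 1:]:]:] * [:0, 1:]"]
    unfolding ind_a_def ind_q_def
    by (simp only: to_fract_1 to_fract_mult to_fract_diff) simp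
  have B: "1 - ind_a * ind_b * ind_q \<noteq> (0 :: 'k ratfun3)"
    using poly0[of "1 - [:[:[:0, 1:]:]:] * [:[:0, 1:]:] * [:0, 1:]"]
    unfolding ind_a_def ind_b_def ind_q_def
    by (simp only: to_fract_1 to_fract_mult to_fract_diff) simp
  have C: "1 - ind_a * ind_b * (ind_q * ind_q) \<noteq> (0 :: 'k ratfun3)"
    using poly0[of "1 - [:[:[:0, 1:]:]:] * [:[:0, 1:]:] * ([:0, 1:] * [:0, 1:])"]
    unfolding ind_a_def ind_b_def ind_q_def
    by (simp only: to_fract_1 to_fract_mult to_fract_diff) simp
  have "w_one ind_a ind_b ind_q 0 0 0 \<noteq> (0 :: 'k ratfun3)"
    using A B C by (simp add: w_one_def power2_eq_square)
  then have "1 \<le> l" if "\<forall>t\<ge>l. \<forall>i j. j \<le> i \<longrightarrow> w_one ind_a ind_b ind_q t i j = (0 :: 'k ratfun3)" for l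
    using that by (cases l) auto
  then show ?thesis
    unfolding lh_height_def by (intro Least_equality) (auto simp: w_one_def)
qed

end

theory Submission
  imports Defs "HOL-Real_Asymp.Real_Asymp"
begin

text \<open>
  Both sides equal \<open>[n, k]\<^sub>q (aq\<^sup>k\<^sup>+\<^sup>1; q)\<^bsub>n-k\<^esub> / (abq\<^sup>2\<^sup>k\<^sup>+\<^sup>2; q)\<^bsub>n-k\<^esub>\<close>, with \<open>[n, k]\<^sub>q\<close> the
  \<open>q\<close>-binomial coefficient. For the mixed moments this amounts to inverting the triangular matrix
  of coefficients of the polynomials \<open>p\<^sub>n\<close>; the sums that must vanish telescope. For the paths, let
  \<open>H(n, j)\<close> be the total weight of the paths from \<open>(k, \<infinity>)\<close> to \<open>v\<^sup>0\<^bsub>n,j\<^esub>\<close>. Looking at the last step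
  gives \<open>H(n + 1, j) = H(n + 1, j + 1) + w(0; n, j) H(n, j)\<close> for \<open>j \<le> n\<close>, where
  \<open>H(n, n) = H(n, n + 1)\<close> is \<open>1\<close> if \<open>n = k\<close> and \<open>0\<close> otherwise, because no east step at height
  \<open>\<ge> 1\<close> has non-zero weight. A closed product formula for \<open>H(n, j)\<close> satisfies this
  recursion by the two \<open>q\<close>-Pascal identities.
\<close>

section \<open>Little \<open>q\<close>-Jacobi polynomials\<close>

lemma qpoch_0 [simp]: "qpoch z q 0 = 1"
  by (simp add: qpoch_def)

lemma qpoch_Suc: "qpoch z q (Suc n) = qpoch z q n * (1 - z * q ^ n)"
  by (simp add: qpoch_def)

lemma qpoch_add: "qpoch z q (m + n) = qpoch z q m * qpoch (z * q ^ m) q n"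
  by (induction n) (simp_all add: qpoch_Suc power_add mult_ac)

lemma qpoch_Suc_left: "qpoch z q (Suc n) = (1 - z) * qpoch (z * q) q n"
  using qpoch_add[of z q 1 n] by (simp add: qpoch_Suc)

lemma qpoch_eq_0_iff: "qpoch (z :: 'a::idom) q n = 0 \<longleftrightarrow> (\<exists>i<n. z * q ^ i = 1)"
  by (auto simp: qpoch_def)

text \<open>The value 0 for \<open>k > n\<close> extends the q-Pascal identities to the boundary and
  is what closes the telescoping sum below.\<close>

definition qbinom :: "'a::field \<Rightarrow> nat \<Rightarrow> nat \<Rightarrow> 'a" where
  "qbinom q n k = (if k \<le> n then qpoch q q n / (qpoch q q k * qpoch q q (n - k)) else 0)"

text \<open>Only the last member of the family has full degree, so comparing leading coefficients
  fixes the last scalar. Cancelling that term leaves a shorter sum, and induction applies.\<close>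

lemma triangular_expansion_unique:
  fixes p :: "nat \<Rightarrow> 'a::idom poly"
  assumes "\<And>k. degree (p k) = k" "\<And>k. p k \<noteq> 0"
    and "(\<Sum>k=0..n. smult (c k) (p k)) = (\<Sum>k=0..n. smult (d k) (p k))" and "k \<le> n"
  shows "c k = d k"
  using assms(3,4)
proof (induction n arbitrary: k)
  case 0
  then have "smult (c 0 - d 0) (p 0) = 0"
    by (simp add: smult_diff_left)
  then show ?case using 0 assms(2) by simp
next
  case (Suc n)
  have low: "coeff (\<Sum>k=0..n. smult (e k) (p k)) (Suc n) = 0" for e
    by (simp add: coeff_sum assms(1) coeff_eq_0)
  have "coeff (\<Sum>k=0..Suc n. smult (c k) (p k)) (Suc n)
      = coeff (\<Sum>k=0..Suc n. smult (d k) (p k)) (Suc n)"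
    using Suc.prems(1) by simp
  then have "c (Suc n) * coeff (p (Suc n)) (Suc n) = d (Suc n) * coeff (p (Suc n)) (Suc n)"
    using low[of c] low[of d] by simp
  moreover have "coeff (p (Suc n)) (Suc n) \<noteq> 0"
    using assms(1,2) by (metis leading_coeff_0_iff)
  ultimately have top: "c (Suc n) = d (Suc n)" by simp
  with Suc.prems(1) have "(\<Sum>k=0..n. smult (c k) (p k)) = (\<Sum>k=0..n. smult (d k) (p k))"
    by simp
  then show ?case using Suc top by (cases "k = Suc n") auto
qed

text \<open>Uniqueness of the expansion makes the definite description in
  \<open>mixed_moments\<close> meaningful, so exhibiting one suitable matrix is enough to identify
  the moments.\<close>

lemma mixed_moments_eqI:
  fixes p :: "nat \<Rightarrow> 'a::field poly"
  assumes "\<And>k. degree (p k) = k" "\<And>k. p k \<noteq> 0"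
    and expansion: "\<And>n. monom 1 n = (\<Sum>k=0..n. smult (\<sigma> n k) (p k))"
    and zero: "\<And>n k. n < k \<Longrightarrow> \<sigma> n k = 0"
  shows "mixed_moments p = \<sigma>"
  unfolding mixed_moments_def
proof (rule the_equality)
  fix \<tau> assume \<tau>: "(\<forall>n. monom 1 n = (\<Sum>k=0..n. smult (\<tau> n k) (p k))) \<and> (\<forall>n k. n < k \<longrightarrow> \<tau> n k = 0)"
  have "\<tau> n k = \<sigma> n k" for n k
  proof (cases "k \<le> n")
    case True
    have "(\<Sum>k=0..n. smult (\<tau> n k) (p k)) = (\<Sum>k=0..n. smult (\<sigma> n k) (p k))"
      using \<tau> expansion[of n] by metis
    then show ?thesis
      using triangular_expansion_unique[OF assms(1,2)] True by blast
  next
    case False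
    then show ?thesis using \<tau> zero by simp
  qed
  then show "\<tau> = \<sigma>" by blast
qed (use expansion zero in blast)

section \<open>q-binomial coefficients and the inverse relation\<close>

locale q_generic =
  fixes q :: "'a::field"
  assumes q_nonzero [simp]: "q \<noteq> 0"
    and q_power_neq_1: "\<And>m. 0 < m \<Longrightarrow> q ^ m \<noteq> 1"
begin

lemma qpoch_q_nonzero [simp]: "qpoch q q n \<noteq> 0"
  using q_power_neq_1[of "Suc _"] by (auto simp: qpoch_eq_0_iff)

lemma qbinom_0 [simp]: "qbinom q n 0 = 1"
  by (simp add: qbinom_def)

lemma qbinom_self [simp]: "qbinom q n n = 1"
  by (simp add: qbinom_def)

lemma qbinom_eq_0 [simp]: "n < k \<Longrightarrow> qbinom q n k = 0"
  by (simp add: qbinom_def)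

lemma qbinom_symmetric: "k \<le> n \<Longrightarrow> qbinom q n (n - k) = qbinom q n k"
  by (simp add: qbinom_def mult.commute)

lemma qbinom_Suc_Suc:
  "qbinom q (Suc n) (Suc k) = qbinom q n k + q ^ Suc k * qbinom q n (Suc k)"
proof (cases "Suc k \<le> n")
  case True
  then obtain r where n: "n = Suc (k + r)" using le_Suc_ex by (metis add_Suc)
  have "1 - q * q ^ k \<noteq> 0" "1 - q * q ^ r \<noteq> 0"
    using q_power_neq_1[of "Suc k"] q_power_neq_1[of "Suc r"] by auto
  then show ?thesis
    unfolding qbinom_def n by (simp add: qpoch_Suc Suc_diff_le divide_simps power_add) algebra
qed (cases "k = n", auto)

lemma qbinom_Suc_Suc':
  "k \<le> n \<Longrightarrow> qbinom q (Suc n) (Suc k) = q ^ (n - k) * qbinom q n k + qbinom q n (Suc k)"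
proof (cases "Suc k \<le> n")
  case True
  then obtain r where n: "n = Suc (k + r)" using le_Suc_ex by (metis add_Suc)
  have "1 - q * q ^ k \<noteq> 0" "1 - q * q ^ r \<noteq> 0"
    using q_power_neq_1[of "Suc k"] q_power_neq_1[of "Suc r"] by auto
  then show ?thesis
    unfolding qbinom_def n by (simp add: qpoch_Suc Suc_diff_le divide_simps power_add) algebra
qed (simp add: not_less_eq_eq)

lemma qbinom_mult_assoc:
  assumes "i \<le> N"
  shows "qbinom q (j + N) (j + i) * qbinom q (j + i) j = qbinom q (j + N) j * qbinom q N i"
  using assms by (simp add: qbinom_def divide_simps)

text \<open>The alternating sum telescopes. At the last index \<open>m = Suc N\<close> the closed
  form contains \<open>qbinom q N (Suc N)\<close>, so the complete sum vanishes.\<close>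

lemma inverse_relation_partial_sum:
  assumes c: "\<And>m. 0 < m \<Longrightarrow> c * q ^ m \<noteq> 1" and "m \<le> Suc N"
  shows "(\<Sum>i\<le>m. (- 1) ^ i * q ^ (i choose 2) * qbinom q (Suc N) i * (1 - c * q ^ (2 * i + 1)) /
             qpoch (c * q ^ Suc i) q (Suc (Suc N)))
       = (- 1) ^ m * q ^ (Suc m choose 2) * qbinom q N m / qpoch (c * q ^ (m + 2)) q (Suc N)"
  using \<open>m \<le> Suc N\<close>
proof (induction m)
  case 0
  have "1 - c * q \<noteq> 0" using c[of 1] by simp
  then show ?case
    by (simp add: numeral_2_eq_2 qpoch_Suc_left[of "c * q"] mult_ac)
next
  case (Suc m)
  \<comment> \<open>\<open>D\<close> is the denominator of the summand with index
    \<open>Suc m\<close>. Splitting off its last factor gives the denominator of the closed form at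
    \<open>m\<close>, splitting off its first factor the one at \<open>Suc m\<close>.\<close>
  define D where "D = qpoch (c * q ^ (m + 2)) q (Suc (Suc N))"
  have D1: "D = (1 - c * q ^ (m + 2)) * qpoch (c * q ^ (Suc m + 2)) q (Suc N)"
    unfolding D_def by (subst qpoch_Suc_left) (simp add: mult_ac)
  have D2: "D = qpoch (c * q ^ (m + 2)) q (Suc N) * (1 - c * q ^ (m + N + 3))"
    unfolding D_def by (subst qpoch_Suc) (simp add: power_add mult_ac numeral_3_eq_3 numeral_2_eq_2)
  have Dnz: "D \<noteq> 0"
  proof -
    have "c * q ^ (m + 2) * q ^ i \<noteq> 1" for i
      using c[of "m + 2 + i"] by (simp add: power_add mult.assoc)
    then show ?thesis unfolding D_def qpoch_eq_0_iff by blast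
  qed
  have f1: "1 / qpoch (c * q ^ (m + 2)) q (Suc N) = (1 - c * q ^ (m + N + 3)) / D"
    using Dnz D2 by (simp add: divide_simps)
  have f2: "1 / qpoch (c * q ^ (Suc m + 2)) q (Suc N) = (1 - c * q ^ (m + 2)) / D"
    using Dnz D1 by (simp add: divide_simps)
  have ch: "q ^ (Suc (Suc m) choose 2) = q ^ (Suc m choose 2) * q ^ Suc m"
    by (simp add: numeral_2_eq_2 power_add)
  have key: "qbinom q N m * (1 - c * q ^ (m + N + 3)) - qbinom q (Suc N) (Suc m) * (1 - c * q ^ (2 * Suc m + 1))
     = - (q ^ Suc m * qbinom q N (Suc m) * (1 - c * q ^ (m + 2)))"
  proof -
    obtain r where r: "N = m + r" using Suc.prems by (auto simp: le_iff_add)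
    have p1: "qbinom q (Suc N) (Suc m) = qbinom q N m + q ^ Suc m * qbinom q N (Suc m)"
      by (rule qbinom_Suc_Suc)
    have p2: "qbinom q (Suc N) (Suc m) = q ^ r * qbinom q N m + qbinom q N (Suc m)"
      using qbinom_Suc_Suc'[of m N] r by simp
    have "m + N + 3 = Suc m + (m + 2) + r" "2 * Suc m + 1 = Suc m + (m + 2)"
      by (simp_all add: r)
    then have e: "q ^ (m + N + 3) = q ^ Suc m * q ^ (m + 2) * q ^ r"
      "q ^ (2 * Suc m + 1) = q ^ Suc m * q ^ (m + 2)"
      by (simp_all only: power_add)
    \<comment> \<open>The terms free of \<open>c\<close> combine by the first Pascal identity, the
      terms containing \<open>c\<close> by the second.\<close>
    have "B * (1 - c * (P * T * R)) - B' * (1 - c * (P * T)) = - (P * B'' * (1 - c * T))"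
      if "B' = B + P * B''" "B' = R * B + B''" for B B' B'' P T R :: 'a
      using that by algebra
    from this[OF p1 p2] show ?thesis unfolding e .
  qed
  have "(\<Sum>i\<le>Suc m. (- 1) ^ i * q ^ (i choose 2) * qbinom q (Suc N) i * (1 - c * q ^ (2 * i + 1)) /
             qpoch (c * q ^ Suc i) q (Suc (Suc N)))
    = (- 1) ^ m * q ^ (Suc m choose 2) * qbinom q N m * (1 / qpoch (c * q ^ (m + 2)) q (Suc N))
      - (- 1) ^ m * q ^ (Suc m choose 2) * qbinom q (Suc N) (Suc m) * (1 - c * q ^ (2 * Suc m + 1)) / D"
    using Suc by (simp add: D_def)
  also have "\<dots> = (- 1) ^ m * q ^ (Suc m choose 2) *
     (qbinom q N m * (1 - c * q ^ (m + N + 3)) - qbinom q (Suc N) (Suc m) * (1 - c * q ^ (2 * Suc m + 1))) / D"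
    unfolding f1 by (simp add: right_diff_distrib diff_divide_distrib mult_ac)
  also have "\<dots> = (- 1) ^ Suc m * q ^ (Suc (Suc m) choose 2) * qbinom q N (Suc m) *
     (1 / qpoch (c * q ^ (Suc m + 2)) q (Suc N))"
    unfolding key f2 ch by simp
  finally show ?case by simp
qed

text \<open>This is the orthogonality behind the inversion of the coefficient matrix. The two
  Pochhammer symbols together skip only the factor \<open>1 - c * q ^ (2 * i + 1)\<close>; supplying
  it in numerator and denominator merges them into one symbol of length \<open>N + 1\<close>, and
  for \<open>N > 0\<close> the telescoping sum applies.\<close>

lemma inverse_relation:
  assumes c: "\<And>m. 0 < m \<Longrightarrow> c * q ^ m \<noteq> 1"
  shows "(\<Sum>i\<le>N. (- 1) ^ i * q ^ (i choose 2) * qbinom q N i /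
            (qpoch (c * q ^ (2 * i + 2)) q (N - i) * qpoch (c * q ^ (i + 1)) q i))
       = (if N = 0 then 1 else 0)"
proof (cases N)
  case (Suc M)
  have "(- 1) ^ i * q ^ (i choose 2) * qbinom q N i /
            (qpoch (c * q ^ (2 * i + 2)) q (N - i) * qpoch (c * q ^ (i + 1)) q i)
      = (- 1) ^ i * q ^ (i choose 2) * qbinom q (Suc M) i * (1 - c * q ^ (2 * i + 1)) /
             qpoch (c * q ^ Suc i) q (Suc (Suc M))" if "i \<le> N" for i
  proof -
    obtain r where r: "N = i + r" using \<open>i \<le> N\<close> by (auto simp: le_iff_add)
    have "qpoch (c * q ^ Suc i) q (Suc N) = qpoch (c * q ^ (i + 1)) q i * qpoch (c * q ^ (2 * i + 1)) q (Suc r)"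
      using qpoch_add[of "c * q ^ Suc i" q i "Suc r"]
      by (simp add: r mult.assoc mult_2 flip: power_add)
    also have "\<dots> = (1 - c * q ^ (2 * i + 1)) * (qpoch (c * q ^ (2 * i + 2)) q (N - i) * qpoch (c * q ^ (i + 1)) q i)"
      by (simp add: qpoch_Suc_left r mult_ac)
    finally have *: "qpoch (c * q ^ Suc i) q (Suc N) = \<dots>" .
    have "1 - c * q ^ (2 * i + 1) \<noteq> 0" using c[of "2 * i + 1"] by simp
    then show ?thesis using * by (simp add: Suc)
  qed
  then have "(\<Sum>i\<le>N. (- 1) ^ i * q ^ (i choose 2) * qbinom q N i /
            (qpoch (c * q ^ (2 * i + 2)) q (N - i) * qpoch (c * q ^ (i + 1)) q i))
     = (\<Sum>i\<le>N. (- 1) ^ i * q ^ (i choose 2) * qbinom q (Suc M) i * (1 - c * q ^ (2 * i + 1)) /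
             qpoch (c * q ^ Suc i) q (Suc (Suc M)))"
    by (intro sum.cong) auto
  also have "\<dots> = 0"
    using inverse_relation_partial_sum[OF c, of N M] Suc by simp
  finally show ?thesis using Suc by simp
qed (simp add: numeral_2_eq_2)

text \<open>Each factor 1 - q^(i-n) equals -q^(i-n) (1 - q^(n-i)). Denominators are cleared, so that
  the induction on \<open>k\<close> involves no quotients.\<close>

lemma qpoch_q_inverse_power:
  "k \<le> n \<Longrightarrow> q ^ (n * k) * qpoch (q powi (- int n)) q k * qpoch q q (n - k)
     = (- 1) ^ k * q ^ (k choose 2) * qpoch q q n"
proof (induction k)
  case (Suc k)
  then obtain r where n: "n = Suc (k + r)" using le_Suc_ex by (metis add_Suc)
  have inv: "q ^ n * (1 - q powi (- int n) * q ^ k) = - (q ^ k * (1 - q * q ^ r))"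
  proof -
    have "q powi (- int n) = inverse (q ^ n)" by (simp add: power_int_minus)
    then have "q ^ n * (1 - q powi (- int n) * q ^ k) = q ^ n - q ^ k" by (simp add: right_diff_distrib)
    then show ?thesis by (simp add: n right_diff_distrib power_add mult_ac)
  qed
  have "q ^ (n * Suc k) * qpoch (q powi (- int n)) q (Suc k) * qpoch q q (n - Suc k)
     = q ^ (n * k) * qpoch (q powi (- int n)) q k * (q ^ n * (1 - q powi (- int n) * q ^ k)) * qpoch q q r"
    unfolding qpoch_Suc by (simp add: n power_add mult_ac)
  also have "\<dots> = - (q ^ k * (q ^ (n * k) * qpoch (q powi (- int n)) q k * qpoch q q (n - k)))"
    unfolding inv by (simp add: n qpoch_Suc mult_ac)
  also have "\<dots> = (- 1) ^ Suc k * q ^ (Suc k choose 2) * qpoch q q n"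
    using Suc by (simp add: numeral_2_eq_2 power_add)
  finally show ?case .
qed (simp add: numeral_2_eq_2)

end

section \<open>Coefficients and mixed moments of the little q-Jacobi polynomials\<close>

text \<open>The conditions keep every Pochhammer symbol that occurs in a denominator different from
  0; the indeterminates are shown to meet them later.\<close>

locale q_jacobi_generic = q_generic q for q :: "'a::field" +
  fixes a b :: 'a
  assumes aq_neq_1: "\<And>m. 0 < m \<Longrightarrow> a * q ^ m \<noteq> 1"
    and abq_neq_1: "\<And>m. 0 < m \<Longrightarrow> a * b * q ^ m \<noteq> 1"
begin

lemma qpoch_a_nonzero [simp]: "0 < m \<Longrightarrow> qpoch (a * q ^ m) q n \<noteq> 0"
  using aq_neq_1 by (auto simp: qpoch_eq_0_iff mult.assoc simp flip: power_add)

lemma qpoch_ab_nonzero [simp]: "0 < m \<Longrightarrow> qpoch (a * b * q ^ m) q n \<noteq> 0"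
  using abq_neq_1 by (auto simp: qpoch_eq_0_iff mult.assoc simp flip: power_add)

text \<open>The series terminates: for \<open>k > n\<close> the symbol (q^(-n); q)_k contains the
  factor 1 - q^(-n) q^n = 0. The formula therefore also gives the right value 0 beyond degree
  \<open>n\<close>.\<close>

lemma coeff_phi21_little_q_jacobi:
  "coeff (phi21 (q powi (- int n)) \<beta> \<gamma> q [:0, q:]) k =
     qpoch (q powi (- int n)) q k * qpoch \<beta> q k / (qpoch q q k * qpoch \<gamma> q k) * q ^ k"
proof -
  have vanish: "qpoch (q powi (- int n)) q k = 0" if "n < k" for k
    using that by (auto simp: qpoch_eq_0_iff power_int_minus intro!: exI[of _ n])
  have pow: "[:0, q:] ^ k = monom (q ^ k) k" for k
    by (metis monom_0 monom_Suc monom_power mult_1 One_nat_def)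
  have "phi21 (q powi (- int n)) \<beta> \<gamma> q [:0, q:] =
     (\<Sum>i\<le>n. smult ((qpoch (q powi (- int n)) q i * qpoch \<beta> q i) / (qpoch q q i * qpoch \<gamma> q i)) (monom (q ^ i) i))"
    unfolding phi21_def pow
  proof (rule Sum_any.expand_superset)
    show "{i. smult ((qpoch (q powi (- int n)) q i * qpoch \<beta> q i) / (qpoch q q i * qpoch \<gamma> q i)) (monom (q ^ i) i) \<noteq> 0} \<subseteq> {..n}"
      using vanish not_le by auto
  qed simp
  then show ?thesis
    using vanish[of k] by (auto simp: coeff_sum if_distrib cong: if_cong)
qed

lemma coeff_little_q_jacobi:
  assumes "k \<le> n"
  shows "coeff (little_q_jacobi a b q n) k =
     (- 1) ^ (n - k) * q ^ ((n - k) choose 2) * qbinom q n k * qpoch (a * q ^ (k + 1)) q (n - k) /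
       qpoch (a * b * q ^ (n + k + 1)) q (n - k)"
proof -
  obtain r where n: "n = k + r" using assms by (auto simp: le_iff_add)
  have A: "qpoch (a * q) q n = qpoch (a * q) q k * qpoch (a * q ^ (k + 1)) q r"
    unfolding n by (simp add: qpoch_add mult_ac)
  have B: "qpoch (a * b * q ^ (n + 1)) q n = qpoch (a * b * q ^ (n + 1)) q k * qpoch (a * b * q ^ (n + k + 1)) q r"
    by (subst (2) n, subst qpoch_add) (simp add: power_add mult_ac)
  \<comment> \<open>Balance of the powers of \<open>q\<close>: \<open>n choose 2\<close> comes from
    the normalising factor, \<open>k choose 2\<close> and \<open>- n * k\<close> from (q^(-n); q)_k,
    and \<open>k\<close> from the argument qx. What remains is \<open>r choose 2\<close>.\<close>
  have e: "(n choose 2) + (k choose 2) + k = n * k + (r choose 2)"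
    unfolding n by (induction k) (simp_all add: numeral_2_eq_2)
  have Q: "qpoch (q powi (- int n)) q k = (- 1) ^ k * q ^ (k choose 2) * qpoch q q n / (q ^ (n * k) * qpoch q q r)"
    using qpoch_q_inverse_power[OF assms] by (simp add: n field_simps)
  have E: "q ^ (n choose 2) * q ^ (k choose 2) * q ^ k = q ^ (n * k) * q ^ (r choose 2)"
    using e by (simp flip: power_add)
  have s: "(- 1 :: 'a) ^ n * (- 1) ^ k = (- 1) ^ r"
    by (simp add: n power_add mult_ac flip: power_mult_distrib)
  have inverse_sign: "inverse ((- 1 :: 'a) ^ n) = (- 1) ^ n"
    by (cases "even n") auto
  have "coeff (little_q_jacobi a b q n) k =
     (qpoch (a * q) q n * ((- 1) ^ n * q ^ (n choose 2)) / qpoch (a * b * q ^ (n + 1)) q n) *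
     (qpoch (q powi (- int n)) q k * qpoch (a * b * q ^ (n + 1)) q k / (qpoch q q k * qpoch (a * q) q k) * q ^ k)"
    unfolding little_q_jacobi_def coeff_smult coeff_phi21_little_q_jacobi
    by (simp add: power_int_minus divide_inverse inverse_sign mult_ac)
  also have "\<dots> = ((- 1) ^ n * (- 1) ^ k) * (q ^ (n choose 2) * q ^ (k choose 2) * q ^ k) *
      (qpoch q q n / (qpoch q q k * qpoch q q r)) * qpoch (a * q ^ (k + 1)) q r /
       qpoch (a * b * q ^ (n + k + 1)) q r / q ^ (n * k)"
    using qpoch_a_nonzero[of 1 k] qpoch_ab_nonzero[of "n + 1" k]
    unfolding A B Q by (simp add: divide_simps)
  also have "\<dots> = (- 1) ^ r * q ^ (r choose 2) * (qpoch q q n / (qpoch q q k * qpoch q q r)) * qpoch (a * q ^ (k + 1)) q r /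
       qpoch (a * b * q ^ (n + k + 1)) q r"
    unfolding E s by (simp add: mult_ac)
  finally show ?thesis
    by (simp add: n qbinom_def mult_ac)
qed

lemma coeff_little_q_jacobi_eq_0: "n < k \<Longrightarrow> coeff (little_q_jacobi a b q n) k = 0"
  unfolding little_q_jacobi_def coeff_smult coeff_phi21_little_q_jacobi
  by (auto simp: qpoch_eq_0_iff power_int_minus intro!: exI[of _ n])

lemma coeff_little_q_jacobi_self [simp]: "coeff (little_q_jacobi a b q n) n = 1"
  by (simp add: coeff_little_q_jacobi numeral_2_eq_2)

lemma degree_little_q_jacobi: "degree (little_q_jacobi a b q n) = n"
  by (intro antisym degree_le le_degree) (auto simp: coeff_little_q_jacobi_eq_0)

text \<open>The formula is verified by comparing coefficients of x^j in the expansion of x^n: the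
  resulting sum over \<open>k\<close> must be 1 for \<open>j = n\<close> and 0 otherwise, which is
  an instance of \<open>inverse_relation\<close>.\<close>

lemma sigma_L_eq:
  assumes "k \<le> n"
  shows "sigma_L a b q n k =
    qbinom q n k * qpoch (a * q ^ (k + 1)) q (n - k) / qpoch (a * b * q ^ (2 * k + 2)) q (n - k)"
proof -
  define \<sigma> where "\<sigma> = (\<lambda>n k. qbinom q n k * qpoch (a * q ^ (k + 1)) q (n - k) /
      qpoch (a * b * q ^ (2 * k + 2)) q (n - k))"
  have "coeff (monom 1 n) j = coeff (\<Sum>k=0..n. smult (\<sigma> n k) (little_q_jacobi a b q k)) j" for n j
  proof (cases "j \<le> n")
    case False
    then show ?thesis
      by (simp add: coeff_sum coeff_little_q_jacobi_eq_0)
  next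
    case True
    then obtain N where n: "n = j + N" by (auto simp: le_iff_add)
    \<comment> \<open>With \<open>k = j + i\<close>, the \<open>ab\<close>-denominators of the
      moment and of the coefficient depend only on this \<open>c\<close> and on \<open>i\<close> and
      \<open>N\<close>, in the shape required by \<open>inverse_relation\<close>.\<close>
    define c where "c = a * b * q ^ (2 * j)"
    have c: "c * q ^ m \<noteq> 1" if "0 < m" for m
      using abq_neq_1[of "2 * j + m"] that by (simp add: c_def power_add mult_ac)
    have "coeff (\<Sum>k=0..n. smult (\<sigma> n k) (little_q_jacobi a b q k)) j =
      (\<Sum>k=0..n. \<sigma> n k * coeff (little_q_jacobi a b q k) j)"
      by (simp add: coeff_sum)
    also have "\<dots> = (\<Sum>k=j..n. \<sigma> n k * coeff (little_q_jacobi a b q k) j)"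
      by (rule sum.mono_neutral_right) (auto simp: coeff_little_q_jacobi_eq_0)
    also have "\<dots> = (\<Sum>i\<le>N. \<sigma> n (j + i) * coeff (little_q_jacobi a b q (j + i)) j)"
      using sum.shift_bounds_cl_nat_ivl[of "\<lambda>k. \<sigma> n k * coeff (little_q_jacobi a b q k) j" 0 j N]
      by (simp add: n atMost_atLeast0 add_ac)
    \<comment> \<open>The two symbols in \<open>a\<close> combine to one of length \<open>N\<close>,
      and the product of q-binomials splits off \<open>qbinom q n j\<close>; both factors are free
      of \<open>i\<close> and leave the sum.\<close>
    also have "\<dots> = (\<Sum>i\<le>N. qbinom q n j * qpoch (a * q ^ (j + 1)) q N *
       ((- 1) ^ i * q ^ (i choose 2) * qbinom q N i /
            (qpoch (c * q ^ (2 * i + 2)) q (N - i) * qpoch (c * q ^ (i + 1)) q i)))"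
    proof (rule sum.cong)
      fix i assume "i \<in> {..N}"
      then obtain r where N: "N = i + r" by (auto simp: le_iff_add)
      have e1: "a * b * q ^ (2 * (j + i) + 2) = c * q ^ (2 * i + 2)"
        "a * b * q ^ (j + i + j + 1) = c * q ^ (i + 1)"
        by (simp_all add: c_def mult.assoc distrib_left mult_2 add_ac flip: power_add)
      have e2: "qpoch (a * q ^ (j + 1)) q N = qpoch (a * q ^ (j + 1)) q i * qpoch (a * q ^ (j + i + 1)) q r"
        unfolding N by (simp add: qpoch_add power_add mult_ac)
      have e3: "qbinom q n (j + i) * qbinom q (j + i) j = qbinom q n j * qbinom q N i"
        unfolding n by (rule qbinom_mult_assoc) (simp add: N)
      have "\<sigma> n (j + i) * coeff (little_q_jacobi a b q (j + i)) j =
        (qbinom q n (j + i) * qbinom q (j + i) j) * qpoch (a * q ^ (j + 1)) q N *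
         ((- 1) ^ i * q ^ (i choose 2)) / (qpoch (c * q ^ (2 * i + 2)) q (N - i) * qpoch (c * q ^ (i + 1)) q i)"
        unfolding \<sigma>_def e2 by (subst coeff_little_q_jacobi) (simp_all only: e1, simp_all add: n N)
      then show "\<sigma> n (j + i) * coeff (little_q_jacobi a b q (j + i)) j =
         qbinom q n j * qpoch (a * q ^ (j + 1)) q N *
       ((- 1) ^ i * q ^ (i choose 2) * qbinom q N i /
            (qpoch (c * q ^ (2 * i + 2)) q (N - i) * qpoch (c * q ^ (i + 1)) q i))"
        unfolding e3 by simp
    qed simp
    also have "\<dots> = (if N = 0 then 1 else 0)"
      by (subst sum_distrib_left[symmetric], subst inverse_relation, erule c) (simp add: n)
    finally show ?thesis by (simp add: n)
  qed
  then have "mixed_moments (little_q_jacobi a b q) = \<sigma>"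
    by (intro mixed_moments_eqI degree_little_q_jacobi poly_eqI)
      (auto simp: \<sigma>_def dest: arg_cong[of _ 0 "\<lambda>p. coeff p _"],
       metis coeff_0 coeff_little_q_jacobi_self zero_neq_one)
  then show ?thesis
    unfolding sigma_L_def by (simp add: \<sigma>_def)
qed

text \<open>The closed formula for \<open>H(n, j)\<close>.\<close>

definition h_from :: "nat \<Rightarrow> nat \<Rightarrow> nat \<Rightarrow> 'a" where
  "h_from k n j = (if n < k then 0 else
     q ^ (j * (n - k)) * qbinom q (n - j) (n - k) *
     (qpoch (a * b * q ^ (k + 1)) q (n - k) * qpoch (a * q ^ (k + 1)) q (n - k)) /
     (qpoch (a * b * q ^ (k + j + 1)) q (n - k) * qpoch (a * b * q ^ (2 * k + 2)) q (n - k)))"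

text \<open>Truncated subtraction turns \<open>n - (n + 1)\<close> into 0, and
  \<open>qbinom q 0 (n - k)\<close> is 1 for \<open>n = k\<close> and 0 for
  \<open>n > k\<close>.\<close>

lemma h_from_top: "h_from k n (n + 1) = (if n = k then 1 else 0)"
  by (simp add: h_from_def)

text \<open>The link between the two sides: at \<open>j = 0\<close> two of the symbols in
  \<open>ab\<close> coincide and cancel.\<close>

lemma h_from_0: "k \<le> n \<Longrightarrow> h_from k n 0 = sigma_L a b q n k"
  using qpoch_ab_nonzero[of "k + 1" "n - k"] by (simp add: h_from_def sigma_L_eq qbinom_symmetric)

lemma h_from_diagonal: "h_from k n n = h_from k n (n + 1)"
  by (cases "n = k") (simp_all add: h_from_def)

lemma h_from_rec:
  assumes "j \<le> n"
  shows "h_from k (Suc n) j = h_from k (Suc n) (j + 1) + w_one a b q 0 n j * h_from k n j"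
proof (cases "k \<le> n")
  case False
  \<comment> \<open>In the borderline case \<open>Suc n = k\<close> both values in row
    \<open>k\<close> are 1 and the value in row \<open>n\<close> is 0.\<close>
  then show ?thesis by (simp add: h_from_def)
next
  case True
  then obtain d where n: "n = k + d" by (auto simp: le_iff_add)
  define c where "c = a * b"
  have cnz: "1 - c * q ^ m \<noteq> 0" if "0 < m" for m
    using abq_neq_1[of m] that by (simp add: c_def)
  \<comment> \<open>\<open>X\<close> and \<open>X'\<close> collect the factors without
    \<open>j\<close> in rows \<open>n\<close> and \<open>Suc n\<close>. Passing from
    \<open>X\<close> to \<open>X'\<close> produces the two numerator factors of the weight that do
    not involve \<open>j\<close>.\<close>
  define X where "X = qpoch (c * q ^ (k + 1)) q d * qpoch (a * q ^ (k + 1)) q d / qpoch (c * q ^ (2 * k + 2)) q d"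
  define X' where "X' = (1 - c * q ^ (n + 1)) * (1 - a * q ^ (n + 1)) / (1 - c * q ^ (n + k + 2)) * X"
  have X': "qpoch (c * q ^ (k + 1)) q (Suc d) * qpoch (a * q ^ (k + 1)) q (Suc d) / qpoch (c * q ^ (2 * k + 2)) q (Suc d) = X'"
  proof -
    have e: "c * q ^ (n + 1) = c * q ^ (k + 1) * q ^ d" "a * q ^ (n + 1) = a * q ^ (k + 1) * q ^ d"
      "c * q ^ (n + k + 2) = c * q ^ (2 * k + 2) * q ^ d"
      by (simp_all add: n mult.assoc mult_2 add_ac flip: power_add)
    show ?thesis unfolding X_def X'_def qpoch_Suc e by (simp add: mult_ac)
  qed
  \<comment> \<open>All three terms of the recursion are brought to the denominator \<open>D\<close>
    times the two denominator factors of the weight. The symbol for \<open>j + 1\<close> starts one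
    factor later, whence the extra factor in \<open>split\<close>.\<close>
  define D where "D = qpoch (c * q ^ (k + j + 1)) q d"
  have D: "D \<noteq> 0" unfolding D_def c_def by (rule qpoch_ab_nonzero) simp
  have D1: "qpoch (c * q ^ (k + j + 1)) q (Suc d) = D * (1 - c * q ^ (n + j + 1))"
    by (simp add: D_def qpoch_Suc n power_add mult_ac)
  have split: "(1 - c * q ^ (k + j + 1)) * qpoch (c * q ^ (k + (j + 1) + 1)) q (Suc d)
      = D * (1 - c * q ^ (n + j + 1)) * (1 - c * q ^ (n + j + 2))" (is "?x * ?y = ?z")
  proof -
    have "?x * ?y = qpoch (c * q ^ (k + j + 1)) q (Suc (Suc d))"
      by (subst qpoch_Suc_left[of _ _ "Suc d"]) (simp add: mult_ac)
    also have "\<dots> = ?z"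
      by (simp add: D_def qpoch_Suc n power_add mult_ac)
    finally show ?thesis .
  qed
  have "?z \<noteq> 0"
    using D cnz[of "n + j + 1"] cnz[of "n + j + 2"] by (simp del: power_Suc)
  then have D2: "1 / ?y = ?x / ?z"
    unfolding split[symmetric] by auto
  have key: "qbinom q (Suc n - j) (Suc d) * (1 - c * q ^ (n + j + 2)) - q ^ Suc d * qbinom q (n - j) (Suc d) * (1 - c * q ^ (k + j + 1))
     = (1 - c * q ^ (n + k + 2)) * qbinom q (n - j) d"
  proof (cases "d \<le> n - j")
    case False
    then show ?thesis by simp
  next
    case True
    then obtain r where r: "n - j = d + r" by (auto simp: le_iff_add)
    then have k: "k = j + r" and s: "Suc n - j = Suc (n - j)" using n assms by auto
    have p1: "qbinom q (Suc n - j) (Suc d) = qbinom q (n - j) d + q ^ Suc d * qbinom q (n - j) (Suc d)"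
      unfolding s by (rule qbinom_Suc_Suc)
    have p2: "qbinom q (Suc n - j) (Suc d) = q ^ r * qbinom q (n - j) d + qbinom q (n - j) (Suc d)"
      unfolding s using qbinom_Suc_Suc'[of d "n - j"] r by simp
    have "n + k + 2 = Suc d + (k + j + 1) + r" "n + j + 2 = Suc d + (k + j + 1)"
      by (simp_all add: n k)
    then have e: "q ^ (n + k + 2) = q ^ Suc d * q ^ (k + j + 1) * q ^ r"
      "q ^ (n + j + 2) = q ^ Suc d * q ^ (k + j + 1)"
      by (simp_all only: power_add)
    \<comment> \<open>Again one Pascal identity settles the terms free of \<open>c\<close> and the
      other those with \<open>c\<close>.\<close>
    have "B' * (1 - c * (P * T)) - P * B'' * (1 - c * T) = (1 - c * (P * T * R)) * B"
      if "B' = B + P * B''" "B' = R * B + B''" for B B' B'' P T R :: 'a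
      using that by algebra
    from this[OF p1 p2] show ?thesis unfolding e .
  qed
  have L: "h_from k (Suc n) j = q ^ (j * Suc d) * qbinom q (Suc n - j) (Suc d) * X' / (D * (1 - c * q ^ (n + j + 1)))"
    unfolding X'[symmetric] D1[symmetric] by (simp add: h_from_def n c_def)
  have R: "h_from k (Suc n) (j + 1) = q ^ (j * Suc d) * q ^ Suc d * qbinom q (n - j) (Suc d) * X' *
     (1 / qpoch (c * q ^ (k + (j + 1) + 1)) q (Suc d))"
    unfolding X'[symmetric] by (simp add: h_from_def n c_def power_add mult_ac)
  have W: "w_one a b q 0 n j * h_from k n j = q ^ (j * Suc d) * qbinom q (n - j) d * (X * (1 - c * q ^ (n + 1)) * (1 - a * q ^ (n + 1))) /
     (D * (1 - c * q ^ (n + j + 1)) * (1 - c * q ^ (n + j + 2)))"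
    by (simp add: w_one_def h_from_def n X_def D_def c_def power_add mult_ac)
  have XX: "X * (1 - c * q ^ (n + 1)) * (1 - a * q ^ (n + 1)) = (1 - c * q ^ (n + k + 2)) * X'"
    unfolding X'_def using cnz[of "n + k + 2"] by simp
  define E where "E = D * (1 - c * q ^ (n + j + 1)) * (1 - c * q ^ (n + j + 2))"
  have L': "h_from k (Suc n) j = q ^ (j * Suc d) * qbinom q (Suc n - j) (Suc d) * X' * (1 - c * q ^ (n + j + 2)) / E"
    unfolding L E_def using cnz[of "n + j + 2"] by simp
  have "h_from k (Suc n) j - h_from k (Suc n) (j + 1) =
     q ^ (j * Suc d) * X' * (qbinom q (Suc n - j) (Suc d) * (1 - c * q ^ (n + j + 2)) - q ^ Suc d * qbinom q (n - j) (Suc d) * (1 - c * q ^ (k + j + 1))) / E"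
    unfolding L' R D2 E_def[symmetric] by (simp add: right_diff_distrib diff_divide_distrib mult_ac)
  also have "\<dots> = w_one a b q 0 n j * h_from k n j"
    unfolding key W XX E_def[symmetric] by simp
  finally show ?thesis by (simp add: algebra_simps)
qed

end

text \<open>A polynomial multiple of a positive power of \<open>q\<close> vanishes at
  \<open>q = 0\<close>, hence is not 1; embedding into the fraction field is injective.\<close>

lemma q_jacobi_generic_ind: "q_jacobi_generic (ind_q :: 'k::field ratfun3) ind_a ind_b"
proof -
  have neq: "to_fract P * ind_q ^ m \<noteq> (1 :: 'k ratfun3)" if "0 < m" for P m
  proof -
    have "poly (P * [:0, 1:] ^ m) 0 \<noteq> poly 1 0" using that by (simp add: power_0_left)
    then have "P * [:0, 1:] ^ m \<noteq> 1" by metis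
    moreover have "(ind_q :: 'k ratfun3) ^ m = to_fract ([:0, 1:] ^ m)"
      by (induction m) (simp_all add: ind_q_def flip: to_fract_mult)
    ultimately show ?thesis by (metis to_fract_1 to_fract_eq_iff to_fract_mult)
  qed
  show ?thesis
  proof
    show "(ind_q :: 'k ratfun3) \<noteq> 0" by (simp add: ind_q_def)
    show "ind_q ^ m \<noteq> (1 :: 'k ratfun3)" if "0 < m" for m
      using neq[OF that, of 1] by simp
    show "ind_a * ind_q ^ m \<noteq> (1 :: 'k ratfun3)" if "0 < m" for m
      using neq[OF that] by (simp add: ind_a_def)
    show "ind_a * ind_b * ind_q ^ m \<noteq> (1 :: 'k ratfun3)" if "0 < m" for m
      using neq[OF that] by (simp add: ind_a_def ind_b_def flip: to_fract_mult)
  qed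
qed

section \<open>Paths in the lecture hall graph\<close>

lemma lh_vertex_eq_iff:
  "lh_vertex t i j = lh_vertex t' i' j' \<longleftrightarrow> i = i' \<and> t * (i + 1) + j = t' * (i + 1) + j'"
proof -
  have "real t + real j / real (i + 1) = real (t * (i + 1) + j) / real (i + 1)" for t j
    by (simp add: field_simps)
  then show ?thesis
    by (auto simp: lh_vertex_def simp del: of_nat_add of_nat_mult mult_Suc_right)
qed

text \<open>Measured in units of 1/(i+1), the height has quotient \<open>t\<close> and remainder
  \<open>j\<close> on division by \<open>i + 1\<close>.\<close>

lemma lh_vertex_inject:
  assumes "j \<le> i" "j' \<le> i'"
  shows "lh_vertex t i j = lh_vertex t' i' j' \<longleftrightarrow> t = t' \<and> i = i' \<and> j = j'"
proof
  assume "lh_vertex t i j = lh_vertex t' i' j'"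
  then have eq: "i = i'" "t * (i + 1) + j = t' * (i + 1) + j'"
    unfolding lh_vertex_eq_iff by blast+
  have "(t * (i + 1) + j) div (i + 1) = t" "(t * (i + 1) + j) mod (i + 1) = j"
    "(t' * (i + 1) + j') div (i + 1) = t'" "(t' * (i + 1) + j') mod (i + 1) = j'"
    using assms eq(1) by (simp_all del: mult_Suc_right)
  then show "t = t' \<and> i = i' \<and> j = j'"
    using eq by metis
qed simp

lemma south_step_iff:
  assumes "j \<le> i"
  shows "south_step u (lh_vertex t i j) \<longleftrightarrow> u = lh_vertex t i (j + 1)"
  using assms by (auto simp: south_step_def lh_vertex_inject)

text \<open>In particular no east step ends on the diagonal \<open>j = i\<close>, because its start
  would lie in column \<open>i - 1\<close> with \<open>j\<close> too large.\<close>

lemma east_step_iff: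
  assumes "j \<le> i"
  shows "east_step u (lh_vertex t i j) \<longleftrightarrow> (\<exists>i'. i = Suc i' \<and> j \<le> i' \<and> u = lh_vertex t i' j)"
proof
  assume "east_step u (lh_vertex t i j)"
  then obtain t' i' j' where *: "j' \<le> i'" "u = lh_vertex t' i' j'" "lh_vertex t i j = lh_vertex t' (i' + 1) j'"
    by (auto simp: east_step_def)
  then have "t = t' \<and> i = i' + 1 \<and> j = j'"
    using assms lh_vertex_inject[of j i j' "i' + 1" t t'] by simp
  then show "\<exists>i'. i = Suc i' \<and> j \<le> i' \<and> u = lh_vertex t i' j"
    using * by auto
qed (auto simp: east_step_def)

lemma east_weight_eq:
  assumes "j \<le> i"
  shows "east_weight w (lh_vertex t i j) (lh_vertex t (i + 1) j) = w t i j"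
proof -
  have "(THE (t', i', j'). j' \<le> i' \<and> lh_vertex t i j = lh_vertex t' i' j' \<and>
      lh_vertex t (i + 1) j = lh_vertex t' (i' + 1) j') = (t, i, j)"
    using assms by (intro the_equality) (auto simp: lh_vertex_inject)
  then show ?thesis by (simp add: east_weight_def)
qed

lemma south_stepD:
  assumes "south_step u v"
  shows "u = (fst v, snd v + 1 / (fst v + 1))"
  using assms by (auto simp: south_step_def lh_vertex_def add_divide_distrib)

lemma east_stepD:
  assumes "east_step u v"
  shows "fst v = Suc (fst u)" "snd v \<le> snd u"
  using assms by (auto simp: east_step_def lh_vertex_def intro!: divide_left_mono)

lemma south_step_imp_not_east_step: "south_step u v \<Longrightarrow> \<not> east_step u v"
  using south_stepD[of u v] east_stepD(1)[of u v] by (metis fst_conv n_not_Suc_n)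

section \<open>Decomposition of path sums by the last step\<close>

text \<open>Allowing an arbitrary end vertex in \<open>SE_paths\<close> keeps the family closed
  under removal of the last step.\<close>

definition SE_from :: "nat \<Rightarrow> nat \<times> real \<Rightarrow> (nat \<Rightarrow> nat \<times> real) set" where
  "SE_from k u =
     {p. p 0 = u \<and>
         ((\<lambda>m. (fst (p m), ereal (snd (p m)))) \<longlonglongrightarrow> (k, \<infinity>)) \<and>
         (\<forall>m. south_step (p (Suc m)) (p m) \<or> east_step (p (Suc m)) (p m))}"

definition weighted_paths where
  "weighted_paths w k u = {p \<in> SE_from k u. path_weight w p \<noteq> 0}"

definition weight_sum where
  "weight_sum w k u = (\<Sum>p\<in>weighted_paths w k u. path_weight w p)"

lemma lh_h_eq_weight_sum: "lh_h w n k = weight_sum w k (n, 0)"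
  by (simp add: lh_h_def weight_sum_def weighted_paths_def SE_from_def SE_paths_def)

text \<open>Columns are natural numbers with the discrete topology, so a convergent sequence of
  columns is eventually constant.\<close>

lemma eventually_fst_SE_from:
  assumes "p \<in> SE_from k u"
  shows "\<forall>\<^sub>F m in sequentially. fst (p m) = k"
proof -
  have "(\<lambda>m. fst (fst (p m), ereal (snd (p m)))) \<longlonglongrightarrow> fst (k, \<infinity> :: ereal)"
    using assms unfolding SE_from_def by (intro tendsto_fst) blast
  then show ?thesis by (simp add: tendsto_discrete)
qed

lemma finite_east_steps:
  assumes "p \<in> SE_from k u"
  shows "finite {m. east_step (p (Suc m)) (p m)}"
proof -
  obtain M where "\<And>m. m \<ge> M \<Longrightarrow> fst (p m) = k"
    using eventually_fst_SE_from[OF assms] by (auto simp: eventually_sequentially)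
  then have "\<not> east_step (p (Suc m)) (p m)" if "M \<le> m" for m
    using that east_stepD(1)[of "p (Suc m)" "p m"] by fastforce
  then have "{m. east_step (p (Suc m)) (p m)} \<subseteq> {..<M}"
    using not_le by auto
  then show ?thesis by (rule finite_subset) simp
qed

text \<open>Since paths are indexed from their end, \<open>case_nat u p\<close> appends the final
  step from \<open>p 0\<close> to \<open>u\<close>; the shift of indices does not affect the
  limit.\<close>

lemma SE_from_case_nat_iff:
  "case_nat u p \<in> SE_from k v \<longleftrightarrow>
     u = v \<and> (south_step (p 0) u \<or> east_step (p 0) u) \<and> p \<in> SE_from k (p 0)"
proof -
  have "(\<forall>m. P m) \<longleftrightarrow> P 0 \<and> (\<forall>m. P (Suc m))" for P
    by (metis not0_implies_Suc)
  note split = this[of "\<lambda>m. south_step (case_nat u p (Suc m)) (case_nat u p m) \<or>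
      east_step (case_nat u p (Suc m)) (case_nat u p m)"]
  show ?thesis
    unfolding SE_from_def mem_Collect_eq split
      filterlim_sequentially_Suc[of "\<lambda>m. (fst (case_nat u p m), ereal (snd (case_nat u p m)))", symmetric]
    by auto
qed

lemma path_weight_case_nat:
  assumes "p \<in> SE_from k u'"
  shows "path_weight w (case_nat u p) =
    (if east_step u' u then east_weight w u' u else 1) * path_weight w p"
proof -
  define E where "E = {m. east_step (p (Suc m)) (p m)}"
  have p0: "p 0 = u'" using assms by (simp add: SE_from_def)
  have fin: "finite (Suc ` E)" using finite_east_steps[OF assms] by (simp add: E_def)
  have set: "{m. east_step (case_nat u p (Suc m)) (case_nat u p m)} =
     (if east_step u' u then {0} else {}) \<union> Suc ` E"
    (is "?L = ?R")
  proof (rule set_eqI)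
    fix m show "m \<in> ?L \<longleftrightarrow> m \<in> ?R"
      by (cases m) (auto simp: E_def p0)
  qed
  have "(\<Prod>m\<in>Suc ` E. east_weight w (case_nat u p (Suc m)) (case_nat u p m)) = path_weight w p"
    by (subst prod.reindex) (auto simp: path_weight_def E_def)
  then show ?thesis
    unfolding path_weight_def[of w "case_nat u p"] set using fin by (simp add: p0)
qed

text \<open>\<open>A\<close> is the set of possible predecessors of \<open>u\<close>. Paths are
  sorted by their last but one vertex, and the weight of the last step factors out of each
  class.\<close>

lemma weight_sum_rec:
  fixes w :: "'a::idom weight_system"
  assumes fin: "finite A" "\<And>u'. u' \<in> A \<Longrightarrow> finite (weighted_paths w k u')"
    and A: "\<And>u'. u' \<in> A \<longleftrightarrow> south_step u' u \<or> east_step u' u"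
  shows "finite (weighted_paths w k u)"
    and "weight_sum w k u =
      (\<Sum>u'\<in>A. (if east_step u' u then east_weight w u' u else 1) * weight_sum w k u')"
proof -
  define B where "B = (\<lambda>u'. case_nat u ` weighted_paths w k u')"
  have sub: "weighted_paths w k u \<subseteq> (\<Union>u'\<in>A. B u')"
  proof
    fix p assume p: "p \<in> weighted_paths w k u"
    have eq: "p = case_nat (p 0) (\<lambda>m. p (Suc m))"
      by (auto simp: fun_eq_iff split: nat.splits)
    then have "case_nat (p 0) (\<lambda>m. p (Suc m)) \<in> SE_from k u"
      using p by (simp add: weighted_paths_def)
    then have *: "p 0 = u" "south_step (p 1) u \<or> east_step (p 1) u" "(\<lambda>m. p (Suc m)) \<in> SE_from k (p 1)"
      unfolding SE_from_case_nat_iff by auto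
    have "path_weight w p = (if east_step (p 1) u then east_weight w (p 1) u else 1) * path_weight w (\<lambda>m. p (Suc m))"
      using path_weight_case_nat[OF *(3), of w u] eq *(1) by simp
    then have "(\<lambda>m. p (Suc m)) \<in> weighted_paths w k (p 1)"
      using p *(3) by (auto simp: weighted_paths_def)
    then show "p \<in> (\<Union>u'\<in>A. B u')"
      using * eq A unfolding B_def by blast
  qed
  have finU: "finite (\<Union>u'\<in>A. B u')"
    using fin by (simp add: B_def)
  show "finite (weighted_paths w k u)"
    using sub finU by (rule finite_subset)
  have inj: "inj_on (case_nat u) X" for X :: "(nat \<Rightarrow> nat \<times> real) set"
  proof (rule inj_onI)
    fix p p' :: "nat \<Rightarrow> nat \<times> real" assume "case_nat u p = case_nat u p'"
    then have "case_nat u p (Suc m) = case_nat u p' (Suc m)" for m by simp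
    then show "p = p'" by (simp add: fun_eq_iff)
  qed
  have in_SE: "p \<in> SE_from k u" if "p \<in> B u'" "u' \<in> A" for p u'
  proof -
    obtain p' where p': "p = case_nat u p'" "p' \<in> SE_from k u'"
      using \<open>p \<in> B u'\<close> by (auto simp: B_def weighted_paths_def)
    then have "p' 0 = u'" by (simp add: SE_from_def)
    then show ?thesis using p' A \<open>u' \<in> A\<close> by (simp add: SE_from_case_nat_iff)
  qed
  \<comment> \<open>The vertex \<open>p 1\<close> reveals the class of a path.\<close>
  have disj: "B u' \<inter> B u'' = {}" if "u' \<noteq> u''" for u' u''
  proof -
    have "p 1 = v" if "p \<in> B v" for p v
      using that by (auto simp: B_def weighted_paths_def SE_from_def)
    then show ?thesis using \<open>u' \<noteq> u''\<close> by blast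
  qed
  \<comment> \<open>The union may also contain paths of weight 0, namely when the last step has
    weight 0; they leave the sum unchanged.\<close>
  have "weight_sum w k u = (\<Sum>p\<in>(\<Union>u'\<in>A. B u'). path_weight w p)"
    unfolding weight_sum_def using sub finU in_SE
    by (intro sum.mono_neutral_left) (auto simp: weighted_paths_def)
  also have "\<dots> = (\<Sum>u'\<in>A. \<Sum>p\<in>B u'. path_weight w p)"
    using fin disj by (intro sum.UNION_disjoint) (auto simp: B_def)
  also have "\<dots> = (\<Sum>u'\<in>A. (if east_step u' u then east_weight w u' u else 1) * weight_sum w k u')"
  proof (rule sum.cong)
    fix u' assume "u' \<in> A"
    have "(\<Sum>p\<in>B u'. path_weight w p) = (\<Sum>p\<in>weighted_paths w k u'. path_weight w (case_nat u p))"
      unfolding B_def by (subst sum.reindex[OF inj]) simp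
    also have "\<dots> = (\<Sum>p\<in>weighted_paths w k u'. (if east_step u' u then east_weight w u' u else 1) * path_weight w p)"
      by (intro sum.cong refl path_weight_case_nat[of _ k]) (simp add: weighted_paths_def)
    also have "\<dots> = (if east_step u' u then east_weight w u' u else 1) * weight_sum w k u'"
      by (simp add: weight_sum_def sum_distrib_left)
    finally show "(\<Sum>p\<in>B u'. path_weight w p) = \<dots>" .
  qed simp
  finally show "weight_sum w k u = \<dots>" .
qed

section \<open>The recursion for path sums and its boundary values\<close>

lemma weight_sum_below_diagonal:
  fixes w :: "'a::idom weight_system"
  assumes "j \<le> i" "finite (weighted_paths w k (lh_vertex t (Suc i) (j + 1)))"
    "finite (weighted_paths w k (lh_vertex t i j))"
  shows "finite (weighted_paths w k (lh_vertex t (Suc i) j))"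
    and "weight_sum w k (lh_vertex t (Suc i) j) =
      weight_sum w k (lh_vertex t (Suc i) (j + 1)) + w t i j * weight_sum w k (lh_vertex t i j)"
proof -
  let ?S = "lh_vertex t (Suc i) (j + 1)" and ?E = "lh_vertex t i j" and ?u = "lh_vertex t (Suc i) j"
  have A: "u' \<in> {?S, ?E} \<longleftrightarrow> south_step u' ?u \<or> east_step u' ?u" for u'
    using assms(1) by (auto simp: south_step_iff east_step_iff)
  note rec = weight_sum_rec[of "{?S, ?E}" w k ?u, OF _ _ A]
  show "finite (weighted_paths w k ?u)"
    using assms by (intro rec(1)) auto
  have "\<not> east_step ?S ?u" "east_step ?E ?u"
    using assms(1) south_step_imp_not_east_step by (auto simp: south_step_iff east_step_iff)
  moreover have "?S \<noteq> ?E"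
    by (simp add: lh_vertex_def)
  moreover have "east_weight w ?E ?u = w t i j"
    using east_weight_eq[OF assms(1), of w t] by simp
  moreover have "weight_sum w k ?u = (\<Sum>u'\<in>{?S, ?E}. (if east_step u' ?u then east_weight w u' ?u else 1) * weight_sum w k u')"
    using assms by (intro rec(2)) auto
  ultimately show "weight_sum w k ?u = weight_sum w k ?S + w t i j * weight_sum w k ?E"
    by simp
qed

lemma weight_sum_diagonal:
  fixes w :: "'a::idom weight_system"
  assumes "finite (weighted_paths w k (lh_vertex t i (i + 1)))"
  shows "finite (weighted_paths w k (lh_vertex t i i))"
    and "weight_sum w k (lh_vertex t i i) = weight_sum w k (lh_vertex t i (i + 1))"
proof -
  let ?S = "lh_vertex t i (i + 1)" and ?u = "lh_vertex t i i"
  have A: "u' \<in> {?S} \<longleftrightarrow> south_step u' ?u \<or> east_step u' ?u" for u'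
    by (auto simp: south_step_iff east_step_iff)
  note rec = weight_sum_rec[of "{?S}" w k ?u, OF _ _ A]
  show "finite (weighted_paths w k ?u)"
    using assms by (intro rec(1)) auto
  have "\<not> east_step ?S ?u"
    using south_step_imp_not_east_step by (auto simp: south_step_iff)
  moreover have "weight_sum w k ?u = (\<Sum>u'\<in>{?S}. (if east_step u' ?u then east_weight w u' ?u else 1) * weight_sum w k u')"
    using assms by (intro rec(2)) auto
  ultimately show "weight_sum w k ?u = weight_sum w k ?S"
    by simp
qed

text \<open>Followed backwards from height 1, a path never descends, so each of its east steps would
  have weight 0. Only south steps remain, and they determine the path.\<close>

lemma weighted_path_above_height_1:
  fixes w :: "'a::idom weight_system"
  assumes w: "\<forall>t>0. \<forall>i. \<forall>j\<le>i. w t i j = 0"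
    and p: "p \<in> weighted_paths w k (i, 1)"
  shows "p = (\<lambda>m. (i, 1 + real m / (i + 1)))"
proof -
  have SE: "p \<in> SE_from k (i, 1)" and nz: "path_weight w p \<noteq> 0"
    using p by (auto simp: weighted_paths_def)
  then have steps: "south_step (p (Suc m)) (p m) \<or> east_step (p (Suc m)) (p m)" and p0: "p 0 = (i, 1)" for m
    by (auto simp: SE_from_def)
  have mono: "snd (p m) \<le> snd (p (Suc m))" for m
    using steps[of m] east_stepD(2) south_stepD[of "p (Suc m)" "p m"] by fastforce
  have high: "1 \<le> snd (p m)" for m
    using lift_Suc_mono_le[of "\<lambda>m. snd (p m)" 0 m] mono p0 by simp
  have "\<not> east_step (p (Suc m)) (p m)" for m
  proof
    assume east: "east_step (p (Suc m)) (p m)"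
    then obtain t i j where *: "j \<le> i" "p (Suc m) = lh_vertex t i j" "p m = lh_vertex t (i + 1) j"
      by (auto simp: east_step_def)
    \<comment> \<open>At \<open>t = 0\<close> the end of the step would have height j/(i+2) with
      \<open>j \<le> i\<close>, which is below 1.\<close>
    have "0 < t"
    proof (rule ccontr)
      assume "\<not> 0 < t"
      then have "snd (p m) < 1" using * by (simp add: lh_vertex_def)
      then show False using high[of m] by simp
    qed
    then have "east_weight w (p (Suc m)) (p m) = 0"
      using * w by (simp only: east_weight_eq)
    then have "path_weight w p = 0"
      unfolding path_weight_def using finite_east_steps[OF SE] east by (intro prod_zero) auto
    then show False using nz by simp
  qed
  then have south: "p (Suc m) = (fst (p m), snd (p m) + 1 / (fst (p m) + 1))" for m
    using steps south_stepD by blast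
  have "p m = (i, 1 + real m / (i + 1))" for m
    by (induction m) (simp_all add: p0 south add_divide_distrib)
  then show ?thesis by blast
qed

lemma weighted_paths_height_1:
  fixes w :: "'a::idom weight_system"
  assumes w: "\<forall>t>0. \<forall>i. \<forall>j\<le>i. w t i j = 0"
  shows "weighted_paths w k (i, 1) = (if i = k then {\<lambda>m. (i, 1 + real m / (i + 1))} else {})"
    and "path_weight w (\<lambda>m. (i, 1 + real m / (i + 1))) = 1"
proof -
  let ?v = "\<lambda>m. (i, 1 + real m / real (i + 1))"
  show weight: "path_weight w ?v = 1"
    using east_stepD(1) by (fastforce simp: path_weight_def intro!: prod.neutral)
  have "south_step (?v (Suc m)) (?v m)" for m
  proof -
    \<comment> \<open>Division by \<open>i + 1\<close> yields the label of the \<open>m\<close>-th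
      vertex; its level is \<open>Suc t\<close> because the path ends at height 1.\<close>
    obtain t j where m: "m = t * (i + 1) + j" and "j \<le> i"
    proof
      show "m = m div (i + 1) * (i + 1) + m mod (i + 1)" by (simp only: div_mult_mod_eq)
      show "m mod (i + 1) \<le> i" using mod_less_divisor[of "i + 1" m] by linarith
    qed
    have "?v m = lh_vertex (Suc t) i j" "?v (Suc m) = lh_vertex (Suc t) i (j + 1)"
      unfolding lh_vertex_def m by (simp_all add: field_simps)
    with \<open>j \<le> i\<close> show ?thesis by (simp only: south_step_iff)
  qed
  moreover have "(\<lambda>m. (i, ereal (1 + real m / real (i + 1)))) \<longlonglongrightarrow> (i, \<infinity>)"
  proof (intro tendsto_Pair tendsto_const)
    have "filterlim (\<lambda>m. 1 + real m / real (i + 1)) at_top sequentially"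
      by real_asymp
    then show "(\<lambda>m. ereal (1 + real m / real (i + 1))) \<longlonglongrightarrow> \<infinity>"
      by (simp add: tendsto_PInfty_eq_at_top)
  qed
  ultimately have "?v \<in> SE_from i (i, 1)"
    by (simp add: SE_from_def)
  then have "?v \<in> weighted_paths w i (i, 1)"
    using weight by (simp add: weighted_paths_def)
  moreover have "i = k" if "?v \<in> weighted_paths w k (i, 1)"
    using eventually_fst_SE_from[of ?v k "(i, 1)"] that by (simp add: weighted_paths_def)
  moreover have "weighted_paths w k (i, 1) \<subseteq> {?v}"
    using weighted_path_above_height_1[OF w] by blast
  ultimately show "weighted_paths w k (i, 1) = (if i = k then {?v} else {})"
    by auto
qed

lemma weight_sum_height_1:
  fixes w :: "'a::idom weight_system"
  assumes "\<forall>t>0. \<forall>i. \<forall>j\<le>i. w t i j = 0"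
  shows "finite (weighted_paths w k (lh_vertex 0 i (i + 1)))"
    and "weight_sum w k (lh_vertex 0 i (i + 1)) = (if i = k then 1 else 0)"
proof -
  have "lh_vertex 0 i (i + 1) = (i, 1)" by (simp add: lh_vertex_def)
  then show "finite (weighted_paths w k (lh_vertex 0 i (i + 1)))"
    "weight_sum w k (lh_vertex 0 i (i + 1)) = (if i = k then 1 else 0)"
    using weighted_paths_height_1(1)[OF assms, of k i] weighted_paths_height_1(2)[OF assms, of i]
    by (auto simp: weight_sum_def)
qed

text \<open>The boundary values and the recursion determine all path sums: induction runs over the
  columns and, within a column, from the diagonal down to \<open>j\<close>. Finiteness is carried
  along because the decomposition by the last step requires it.\<close>

lemma weight_sum_eqI:
  fixes w :: "'a::idom weight_system" and H :: "nat \<Rightarrow> nat \<Rightarrow> 'a"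
  assumes w: "\<forall>t>0. \<forall>i. \<forall>j\<le>i. w t i j = 0"
    and top: "\<And>i. H i (i + 1) = (if i = k then 1 else 0)"
    and diag: "\<And>i. H i i = H i (i + 1)"
    and rec: "\<And>i j. j \<le> i \<Longrightarrow> H (Suc i) j = H (Suc i) (j + 1) + w 0 i j * H i j"
    and "j \<le> i"
  shows "finite (weighted_paths w k (lh_vertex 0 i j)) \<and> weight_sum w k (lh_vertex 0 i j) = H i j"
  using \<open>j \<le> i\<close>
proof (induction i arbitrary: j)
  case 0
  then show ?case
    using weight_sum_diagonal[of w k 0 0] weight_sum_height_1[of w k 0] w top[of 0] diag[of 0] by simp
next
  case (Suc i)
  have diagonal: "finite (weighted_paths w k (lh_vertex 0 (Suc i) (Suc i))) \<and>
      weight_sum w k (lh_vertex 0 (Suc i) (Suc i)) = H (Suc i) (Suc i)"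
    using weight_sum_diagonal[of w k 0 "Suc i"] weight_sum_height_1[of w k "Suc i"] w
      top[of "Suc i"] diag[of "Suc i"] by simp
  from \<open>j \<le> Suc i\<close> show ?case
  proof (induction rule: inc_induct)
    case (step j)
    then show ?case
      using weight_sum_below_diagonal[of j i w k 0] Suc.IH[of j] rec[of j i] by simp
  qed (rule diagonal)
qed

theorem proposition4p14:
  fixes n k :: nat
  assumes "k \<le> n"
  shows "sigma_L (ind_a :: 'k::field ratfun3) ind_b ind_q n k = lh_h (w_one ind_a ind_b ind_q) n k"
proof -
  interpret q_jacobi_generic "ind_q :: 'k ratfun3" ind_a ind_b
    by (rule q_jacobi_generic_ind)
  let ?w = "w_one (ind_a :: 'k ratfun3) ind_b ind_q"
  \<comment> \<open>The remaining premise, that weights vanish for \<open>t > 0\<close>, is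
    immediate from the definition of \<open>w_one\<close>.\<close>
  have "weight_sum ?w k (lh_vertex 0 n 0) = h_from k n 0"
    using weight_sum_eqI[of ?w "h_from k" k 0 n, OF _ h_from_top h_from_diagonal h_from_rec]
    by (simp add: w_one_def)
  then show ?thesis
    using assms by (simp add: lh_h_eq_weight_sum lh_vertex_def h_from_0)
qed

end
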